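(* Let $p\in\mathbb{N}$ be an odd prime and let $\omega_p=\exp(2\pi i/p)\in\mathbb{C}$. Then all minors (that is, determinants of square submatrices of every size, obtained by choosing arbitrary row and column index sets of equal nonzero cardinality) of the real Vandermonde matrix $$\left(\left(\omega_p^{j}+\omega_p^{-j}\right)^{m}\right)_{j,m=1,\ldots,\frac{p-1}{2}}\in\mathbb{R}^{\frac{p-1}{2}\times\frac{p-1}{2}}$$ are nonzero.
   Context: Here $j$ is the row index and $m$ is the column index. Note $\omega_p^j+\omega_p^{-j}=2\cos(2\pi j/p)$ is real. *)

theory Defs
  imports
    Complex_Main
    "HOL-Computational_Algebra.Primes"
    "Jordan_Normal_Form.Determinant"
    "Jordan_Normal_Form.DL_Submatrix"
begin

definition omega :: "nat \<Rightarrow> complex" where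
  "omega p = exp (2 * of_real pi * \<i> / of_nat p)"

(* The complex number under Re is real, see complex_of_real_node below;
   Re only moves it into the type real. *)
definition node :: "nat \<Rightarrow> nat \<Rightarrow> real" where
  "node p j = Re (omega p ^ j + omega p powi (- int j))"

lemma omega_powi: "omega p powi k = cis (2 * pi * of_int k / of_nat p)"
proof -
  have "omega p = cis (2 * pi / of_nat p)"
    by (simp add: omega_def cis_conv_exp mult_ac)
  then show ?thesis
    by (simp add: cis_power_int mult_ac)
qed

lemma complex_of_real_node:
  "complex_of_real (node p j) = omega p ^ j + omega p powi (- int j)"
  using omega_powi[of p "int j"] omega_powi[of p "- int j"]
  by (simp add: node_def complex_eq_iff)

lemma node_eq_cos: "node p j = 2 * cos (2 * pi * real j / real p)"
  using omega_powi[of p "int j"] omega_powi[of p "- int j"]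
  by (simp add: node_def)

(* Matrices of type mat are indexed from 0, whereas the rows j and the columns m
   of this Vandermonde matrix run over 1, ..., (p - 1) / 2. *)
definition vandermonde_mat :: "nat \<Rightarrow> real mat" where
  "vandermonde_mat p =
     mat ((p - 1) div 2) ((p - 1) div 2) (\<lambda>(j, m). node p (j + 1) ^ (m + 1))"

end

theory Submission
  imports Defs "Jordan_Normal_Form.Char_Poly"
begin

text \<open>
  Write \<open>x\<^sub>r\<close> for the nodes in the chosen rows and \<open>m\<^sub>k\<close> for the exponents in the chosen
  columns. A generalised Vandermonde determinant \<open>det (x\<^sub>r ^ m\<^sub>k)\<close> is the ordinary Vandermonde
  product of the \<open>x\<^sub>r\<close> times a Schur polynomial in them, which has integer coefficients. The
  product is nonzero because the nodes \<open>2 cos (2 \<pi> j / p)\<close> with \<open>2 j < p\<close> are distinct, so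
  everything depends on the Schur factor \<open>S\<close>.

  The factor \<open>S\<close> is handled arithmetically. Each node is the value at \<open>T = \<omega>\<close> of
  \<open>T ^ j + T ^ (p - j)\<close>, so \<open>S\<close> is the value at \<open>\<omega>\<close> of a polynomial over the integers.
  Modulo the prime \<open>1 - \<omega>\<close> above \<open>p\<close>, a polynomial expression in \<open>\<omega>\<close> agrees with its value
  at \<open>T = 1\<close>; hence an integer polynomial that vanishes at \<open>\<omega>\<close> takes a multiple of \<open>p\<close> at 1
  (\<open>prime_dvd_poly_1_of_root_of_unity_root\<close>). At \<open>T = 1\<close> all nodes become 2, and there \<open>S\<close>
  equals, up to powers of 2 and factorials, \<open>\<Prod>\<^bsub>l < k\<^esub> (m\<^sub>k - m\<^sub>l)\<close>. Since \<open>p\<close> is odd and the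
  exponents are distinct numbers below \<open>p\<close>, this is prime to \<open>p\<close>
  (\<open>not_dvd_det_divdiff_const\<close>), and so \<open>S\<close> is not zero at \<open>\<omega>\<close>.

  The Schur factor appears as the determinant of the divided differences of the monomials, through
  Newton's interpolation formula (\<open>det_node_powers\<close>). The same formula, with integers as nodes,
  turns the binomial coefficients that occur at equal nodes into a Vandermonde determinant.
\<close>

section \<open>Reduction of integer polynomials at a root of unity\<close>

lemma add_power_prime_ex:
  fixes x y :: "'a::comm_ring_1"
  assumes "prime p"
  shows "\<exists>z. (x + y) ^ p = x ^ p + y ^ p + of_nat p * z"
proof -
  have p: "0 < p" using assms prime_gt_0_nat by blast
  define c where "c k = of_nat (p choose k) * x ^ k * y ^ (p - k)" for k
  have "of_nat p dvd c k" if "k \<in> {0<..<p}" for k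
  proof -
    have "p dvd (p choose k)"
      using that assms p by (intro dvd_choose_prime) auto
    then show ?thesis by (auto simp: c_def mult.assoc elim!: dvdE)
  qed
  then have "of_nat p dvd (\<Sum>k\<in>{0<..<p}. c k)"
    by (rule dvd_sum)
  then obtain z where z: "(\<Sum>k\<in>{0<..<p}. c k) = of_nat p * z" by (elim dvdE)
  have "{..p} = insert 0 (insert p {0<..<p})" using p by auto
  then have "(x + y) ^ p = c 0 + (c p + (\<Sum>k\<in>{0<..<p}. c k))"
    using p unfolding binomial_ring c_def by simp
  then show ?thesis
    using z p by (intro exI[of _ z]) (simp add: c_def algebra_simps)
qed

text \<open>
  Multiplication by \<open>h(\<omega>)\<close> permutes and combines the powers \<open>1, \<omega>, \<dots>, \<omega> ^ (n - 1)\<close> with integer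
  coefficients, so \<open>h(\<omega>)\<close> is an eigenvalue of an integer circulant matrix and a root of its monic
  characteristic polynomial.
\<close>
lemma algebraic_int_poly_root_of_unity:
  fixes \<omega> :: "'a::field_char_0"
  assumes "\<omega> ^ n = 1" "0 < n"
  shows "algebraic_int (poly (map_poly of_int h) \<omega>)"
proof -
  define C :: "int mat" where
    "C = mat n n (\<lambda>(i, j). \<Sum>k\<le>degree h. if (i + k) mod n = j then coeff h k else 0)"
  define v where "v = vec n (\<lambda>i. \<omega> ^ i)"
  define x where "x = poly (map_poly of_int h) \<omega>"
  have C: "C \<in> carrier_mat n n" by (simp add: C_def)
  have red: "\<omega> ^ (k mod n) = \<omega> ^ k" for k
  proof -
    have "\<omega> ^ k = \<omega> ^ (n * (k div n) + k mod n)" by simp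
    then show ?thesis using assms(1) by (simp only: power_add power_mult) simp
  qed
  have x: "x = (\<Sum>k\<le>degree h. of_int (coeff h k) * \<omega> ^ k)"
    by (simp add: x_def poly_altdef)
  have "map_mat of_int C *\<^sub>v v = x \<cdot>\<^sub>v v"
  proof (rule eq_vecI)
    fix i assume "i < dim_vec (x \<cdot>\<^sub>v v)"
    then have i: "i < n" by (simp add: v_def)
    have "(map_mat of_int C *\<^sub>v v) $ i
        = (\<Sum>j<n. (\<Sum>k\<le>degree h. if (i + k) mod n = j then of_int (coeff h k) else 0) * \<omega> ^ j)"
      using i by (simp add: C_def v_def scalar_prod_def atLeast0LessThan of_int_sum if_distrib cong: if_cong)
    also have "\<dots> = (\<Sum>j<n. \<Sum>k\<le>degree h. if (i + k) mod n = j then of_int (coeff h k) * \<omega> ^ j else 0)"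
      by (simp add: sum_distrib_right if_distrib[of "\<lambda>t. t * _"] cong: if_cong)
    also have "\<dots> = (\<Sum>k\<le>degree h. \<Sum>j<n. if (i + k) mod n = j then of_int (coeff h k) * \<omega> ^ j else 0)"
      by (rule sum.swap)
    also have "\<dots> = (\<Sum>k\<le>degree h. of_int (coeff h k) * \<omega> ^ (i + k))"
      using assms(2) by (simp add: red)
    also have "\<dots> = (x \<cdot>\<^sub>v v) $ i"
      using i by (simp add: v_def x sum_distrib_left sum_distrib_right power_add mult_ac)
    finally show "(map_mat of_int C *\<^sub>v v) $ i = (x \<cdot>\<^sub>v v) $ i" .
  qed (simp add: C_def v_def)
  moreover have "v \<noteq> 0\<^sub>v n"
  proof
    assume "v = 0\<^sub>v n"
    then have "v $ 0 = 0\<^sub>v n $ 0" by simp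
    then show False using assms(2) by (simp add: v_def)
  qed
  ultimately have "eigenvalue (map_mat of_int C) x"
    unfolding eigenvalue_def eigenvector_def using C by (auto simp: v_def intro!: exI[of _ v])
  then have "poly (char_poly (map_mat of_int C)) x = 0"
    using eigenvalue_root_char_poly[of "map_mat of_int C" n x] C by simp
  then have "poly (map_poly of_int (char_poly C)) x = 0"
    by (simp add: of_int_hom.char_poly_hom[OF C])
  moreover have "lead_coeff (char_poly C) = 1"
    using degree_monic_char_poly[OF C] by simp
  ultimately show ?thesis
    unfolding algebraic_int_altdef_ipoly x_def[symmetric] by blast
qed

text \<open>
  This is the Frobenius map modulo \<open>p\<close>: taking \<open>p\<close>-th powers is additive modulo \<open>p\<close> and sends
  every power of \<open>\<omega>\<close> to 1. Both \<open>f(\<omega>) ^ p\<close> and \<open>f(1) ^ p\<close> are therefore congruent to the sum of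
  the \<open>p\<close>-th powers of the coefficients.
\<close>
lemma poly_root_of_unity_power_prime:
  fixes \<omega> :: "'a::field_char_0"
  assumes "prime p" "\<omega> ^ p = 1"
  shows "\<exists>g. poly (map_poly of_int f) \<omega> ^ p
             = of_int (poly f 1 ^ p) + of_nat p * poly (map_poly of_int g) \<omega>"
proof (induction f)
  case 0
  then show ?case using prime_gt_0_nat[OF assms(1)] by (intro exI[of _ 0]) simp
next
  case (pCons a f)
  let ?e = "\<lambda>f. poly (map_poly of_int f) \<omega>"
  interpret e: comm_ring_hom ?e
    by unfold_locales (auto simp: hom_distribs)
  obtain g where g: "?e f ^ p = of_int (poly f 1 ^ p) + of_nat p * ?e g"
    using pCons.IH by blast
  obtain z where z: "([:a:] + [:0, 1:] * f) ^ p = [:a:] ^ p + ([:0, 1:] * f) ^ p + of_nat p * z"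
    using add_power_prime_ex[OF assms(1)] by blast
  obtain w where w: "(a + poly f 1) ^ p = a ^ p + poly f 1 ^ p + of_nat p * w"
    using add_power_prime_ex[OF assms(1)] by blast
  have "?e (pCons a f) ^ p = ?e (([:a:] + [:0, 1:] * f) ^ p)"
    by (simp add: hom_distribs)
  also have "\<dots> = of_int a ^ p + \<omega> ^ p * ?e f ^ p + of_nat p * ?e z"
    unfolding z by (simp add: hom_distribs power_mult_distrib)
  also have "\<dots> = of_int (poly (pCons a f) 1 ^ p) + of_nat p * ?e (g + z - [:w:])"
    using arg_cong[OF w, of "of_int :: int \<Rightarrow> 'a"]
    by (simp add: g assms(2) algebra_simps hom_distribs)
  finally show ?case by blast
qed

text \<open>
  By the Frobenius congruence, \<open>f(1) ^ p / p\<close> is an integer polynomial in \<open>\<omega>\<close>. It is thus a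
  rational algebraic integer, hence an integer.
\<close>
lemma prime_dvd_poly_1_of_root_of_unity_root:
  fixes \<omega> :: "'a::field_char_0"
  assumes "prime p" "\<omega> ^ p = 1" "poly (map_poly of_int f) \<omega> = 0"
  shows "int p dvd poly f 1"
proof -
  have p: "0 < p" using assms(1) prime_gt_0_nat by blast
  obtain g where "poly (map_poly of_int f) \<omega> ^ p
      = of_int (poly f 1 ^ p) + of_nat p * poly (map_poly of_int g) \<omega>"
    using poly_root_of_unity_power_prime[OF assms(1,2)] by blast
  then have eq: "of_int (poly f 1 ^ p) = of_nat p * poly (map_poly of_int (- g)) \<omega>"
    using p by (simp add: assms(3) power_0_left hom_distribs eq_neg_iff_add_eq_0)
  define x where "x = poly (map_poly of_int (- g)) \<omega>"
  have "x = of_int (poly f 1 ^ p) / of_nat p"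
    using eq p by (simp add: x_def)
  then have "x \<in> \<rat>" by simp
  then have "x \<in> \<int>"
    using rational_algebraic_int_is_int algebraic_int_poly_root_of_unity[OF assms(2) p]
    unfolding x_def by blast
  then obtain c where "x = of_int c" by (elim Ints_cases)
  then have "(of_int (poly f 1 ^ p) :: 'a) = of_int (int p * c)"
    using eq by (simp add: x_def)
  then have "poly f 1 ^ p = int p * c" by (simp only: of_int_eq_iff)
  then have "int p dvd poly f 1 ^ p" by simp
  then show ?thesis
    using assms(1) prime_dvd_power[of "int p"] by simp
qed

section \<open>Divided differences of monomials\<close>

text \<open>
  \<open>divdiff a i e\<close> is the divided difference of \<open>x ^ e\<close> at the nodes \<open>a 0, \<dots>, a i\<close>, that is, the
  complete homogeneous symmetric polynomial of degree \<open>e - i\<close> in these nodes (and 0 if \<open>e < i\<close>).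
  The recursion on \<open>e\<close> involves no division, so it makes sense in every commutative ring, for
  coinciding nodes as well, and it commutes with ring homomorphisms.
\<close>
fun divdiff :: "(nat \<Rightarrow> 'a::comm_ring_1) \<Rightarrow> nat \<Rightarrow> nat \<Rightarrow> 'a" where
  "divdiff a 0 0 = 1"
| "divdiff a (Suc i) 0 = 0"
| "divdiff a 0 (Suc e) = a 0 * divdiff a 0 e"
| "divdiff a (Suc i) (Suc e) = divdiff a i e + a (Suc i) * divdiff a (Suc i) e"

lemma divdiff_eq_0: "e < i \<Longrightarrow> divdiff a i e = 0"
  by (induction a i e rule: divdiff.induct) auto

lemma divdiff_diag [simp]: "divdiff a i i = 1"
  by (induction i) (auto simp: divdiff_eq_0)

lemma divdiff_const: "divdiff (\<lambda>_. c) i e = of_nat (e choose i) * c ^ (e - i)"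
proof (induction "\<lambda>_::nat. c" i e rule: divdiff.induct)
  case (4 i e)
  have "c ^ (e - i) = c * c ^ (e - Suc i)" if "i < e"
    using that by (metis Suc_diff_Suc power_Suc)
  with 4 show ?case
    by (cases "i < e") (auto simp: algebra_simps binomial_eq_0)
qed auto

lemma (in comm_ring_hom) hom_divdiff: "hom (divdiff a i e) = divdiff (\<lambda>r. hom (a r)) i e"
  by (induction a i e rule: divdiff.induct) (auto simp: hom_distribs)

definition newton_basis :: "(nat \<Rightarrow> 'a::comm_ring_1) \<Rightarrow> nat \<Rightarrow> 'a \<Rightarrow> 'a" where
  "newton_basis a i x = (\<Prod>l<i. x - a l)"

text \<open>
  Newton's interpolation formula. The induction step multiplies the formula for \<open>x ^ e\<close> by
  \<open>x = (x - a i) + a i\<close>, which gives precisely the recursion of \<open>divdiff\<close>.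
\<close>
lemma power_eq_newton_sum:
  assumes "e < m"
  shows "x ^ e = (\<Sum>i<m. newton_basis a i x * divdiff a i e)"
  using assms
proof (induction e arbitrary: m)
  case 0
  have "newton_basis a i x * divdiff a i 0 = (if i = 0 then 1 else 0)" for i
    by (cases i) (auto simp: newton_basis_def)
  then show ?case using 0 by simp
next
  case (Suc e)
  then obtain m' where m': "m = Suc m'" "e < m'" by (cases m) auto
  let ?N = "\<lambda>i. newton_basis a i x"
  have "(\<Sum>i<m. ?N i * divdiff a i (Suc e))
      = (\<Sum>i<m'. ?N (Suc i) * divdiff a i e) + (\<Sum>i<Suc m'. ?N i * a i * divdiff a i e)"
    unfolding m'(1) sum.lessThan_Suc_shift by (simp add: algebra_simps sum.distrib)
  also have "(\<Sum>i<Suc m'. ?N i * a i * divdiff a i e) = (\<Sum>i<m'. ?N i * a i * divdiff a i e)"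
    using m' by (simp add: divdiff_eq_0)
  also have "(\<Sum>i<m'. ?N (Suc i) * divdiff a i e) + \<dots> = x * (\<Sum>i<m'. ?N i * divdiff a i e)"
    by (simp add: newton_basis_def algebra_simps sum_distrib_left flip: sum.distrib)
  finally show ?case using Suc.IH[OF m'(2)] by simp
qed

lemma newton_basis_node_eq_0: "j < i \<Longrightarrow> newton_basis a i (a j) = 0"
  unfolding newton_basis_def by (rule prod_zero) auto

text \<open>
  At a node the terms from \<open>n\<close> on vanish for every exponent, so a square matrix of basis values
  suffices however large \<open>e\<close> is.
\<close>
lemma node_power_eq_newton_sum:
  assumes "j < n"
  shows "a j ^ e = (\<Sum>i<n. newton_basis a i (a j) * divdiff a i e)"
proof -
  have "a j ^ e = (\<Sum>i<n + Suc e. newton_basis a i (a j) * divdiff a i e)"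
    by (rule power_eq_newton_sum) simp
  also have "\<dots> = (\<Sum>i<n. newton_basis a i (a j) * divdiff a i e)"
    using assms by (intro sum.mono_neutral_right) (auto simp: newton_basis_node_eq_0)
  finally show ?thesis .
qed

section \<open>Generalised Vandermonde determinants\<close>

text \<open>
  Newton's formula factors the matrix of powers into the matrix of basis values at the nodes, which
  is lower triangular, and the matrix of divided differences. The second factor has the Schur
  polynomial as its determinant.
\<close>
lemma det_node_powers:
  fixes a :: "nat \<Rightarrow> 'a::comm_ring_1"
  shows "det (mat n n (\<lambda>(j, k). a j ^ e k))
       = (\<Prod>j<n. \<Prod>l<j. a j - a l) * det (mat n n (\<lambda>(i, k). divdiff a i (e k)))"
proof -
  let ?L = "mat n n (\<lambda>(j, i). newton_basis a i (a j))"
  let ?D = "mat n n (\<lambda>(i, k). divdiff a i (e k))"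
  have "mat n n (\<lambda>(j, k). a j ^ e k) = ?L * ?D"
    by (rule eq_matI) (auto simp: scalar_prod_def atLeast0LessThan node_power_eq_newton_sum[of _ n])
  then have "det (mat n n (\<lambda>(j, k). a j ^ e k)) = det ?L * det ?D"
    by (simp add: det_mult[of _ n])
  also have "det ?L = prod_list (diag_mat ?L)"
    by (rule det_lower_triangular[of n]) (auto simp: newton_basis_node_eq_0)
  also have "\<dots> = (\<Prod>j<n. \<Prod>l<j. a j - a l)"
    by (simp add: prod_list_diag_prod newton_basis_def atLeast0LessThan)
  finally show ?thesis .
qed

lemma det_unitriangular_divdiff: "det (mat n n (\<lambda>(i, k). divdiff a i k)) = 1"
proof -
  let ?D = "mat n n (\<lambda>(i, k). divdiff a i k)"
  have "det ?D = prod_list (diag_mat ?D)"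
    by (rule det_upper_triangular[of _ n]) (auto simp: divdiff_eq_0)
  then show ?thesis by (simp add: prod_list_diag_prod)
qed

text \<open>
  The Newton basis and the monomials differ by a unitriangular change of basis, so this determinant
  is the Vandermonde determinant; its nodes \<open>b\<close> drop out.
\<close>
lemma det_newton_basis:
  fixes x :: "nat \<Rightarrow> 'a::comm_ring_1"
  shows "det (mat n n (\<lambda>(k, i). newton_basis b i (x k))) = (\<Prod>k<n. \<Prod>l<k. x k - x l)"
proof -
  let ?F = "mat n n (\<lambda>(k, i). newton_basis b i (x k))"
  let ?U = "mat n n (\<lambda>(i, e). divdiff b i e)"
  have "mat n n (\<lambda>(k, e). x k ^ e) = ?F * ?U"
    by (rule eq_matI) (auto simp: scalar_prod_def atLeast0LessThan power_eq_newton_sum[of _ n])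
  then have "det (mat n n (\<lambda>(k, e). x k ^ e)) = det ?F"
    by (simp add: det_mult[of _ n] det_unitriangular_divdiff)
  then show ?thesis
    using det_node_powers[of n x "\<lambda>e. e"] by (simp add: det_unitriangular_divdiff)
qed

lemma det_diagonal: "det (mat n n (\<lambda>(i, j). if i = j then d i else 0)) = (\<Prod>i<n. d i)"
proof -
  let ?D = "mat n n (\<lambda>(i, j). if i = j then d i else 0)"
  have "det ?D = prod_list (diag_mat ?D)"
    by (rule det_upper_triangular[of _ n]) auto
  then show ?thesis by (simp add: prod_list_diag_prod atLeast0LessThan)
qed

text \<open>
  With the nodes \<open>0, 1, 2, \<dots>\<close> the Newton basis consists of the falling factorials.
\<close>
lemma fact_mult_binomial_eq_newton_basis:
  "int (fact i * (m choose i)) = newton_basis int i (int m)"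
proof (induction i)
  case (Suc i)
  have step: "Suc i * (m choose Suc i) = (m choose i) * (m - i)"
    using binomial_absorption[of i m] binomial_absorb_comp[of m i] by (simp only: mult.commute)
  have "int (fact (Suc i) * (m choose Suc i)) = int (fact i * (Suc i * (m choose Suc i)))"
    by (simp only: fact_Suc mult_ac of_nat_id)
  also have "\<dots> = int (fact i * (m choose i)) * (int m - int i)"
    unfolding step by (cases "i \<le> m") (simp_all add: of_nat_diff)
  also have "\<dots> = newton_basis int (Suc i) (int m)"
    unfolding Suc.IH by (simp add: newton_basis_def)
  finally show ?case .
qed (simp add: newton_basis_def)

text \<open>
  At equal nodes the divided differences are \<open>(m\<^sub>k choose i) * c ^ (m\<^sub>k - i)\<close>. Scaling row \<open>i\<close> by
  \<open>c ^ i * fact i\<close> turns them into falling factorials of \<open>m\<^sub>k\<close> times \<open>c ^ m\<^sub>k\<close>, whose determinant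
  is a Vandermonde product. The scaling is stated as a product to stay within the integers.
\<close>
lemma det_divdiff_const:
  fixes c :: int and m :: "nat \<Rightarrow> nat"
  shows "(\<Prod>i<n. c ^ i * fact i) * det (mat n n (\<lambda>(i, k). divdiff (\<lambda>_. c) i (m k)))
       = (\<Prod>k<n. \<Prod>l<k. int (m k) - int (m l)) * (\<Prod>k<n. c ^ m k)"
proof -
  let ?D = "mat n n (\<lambda>(i, k). divdiff (\<lambda>_. c) i (m k))"
  let ?F = "mat n n (\<lambda>(k, i). newton_basis int i (int (m k)))"
  let ?diag = "\<lambda>d. mat n n (\<lambda>(i, j). if i = j then d i else (0::int))"
  have entry: "c ^ i * fact i * divdiff (\<lambda>_. c) i e = newton_basis int i (int e) * c ^ e" for i e
    by (cases "i \<le> e")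
       (auto simp: divdiff_const mult_ac simp flip: fact_mult_binomial_eq_newton_basis power_add)
  have "?diag (\<lambda>i. c ^ i * fact i) * ?D = transpose_mat ?F * ?diag (\<lambda>k. c ^ m k)"
    by (rule eq_matI) (auto simp: scalar_prod_def entry if_distrib if_distribR cong: if_cong)
  then have "det (?diag (\<lambda>i. c ^ i * fact i)) * det ?D = det ?F * det (?diag (\<lambda>k. c ^ m k))"
    by (metis (no_types, lifting) det_mult det_transpose mat_carrier transpose_carrier_mat)
  then show ?thesis by (simp add: det_diagonal det_newton_basis)
qed

lemma not_dvd_det_divdiff_const:
  fixes c :: int
  assumes "prime p" "\<not> int p dvd c"
    and m: "\<And>k l. l < k \<Longrightarrow> k < n \<Longrightarrow> m l < m k \<and> m k < p"
  shows "\<not> int p dvd det (mat n n (\<lambda>(i, k). divdiff (\<lambda>_. c) i (m k)))"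
proof
  assume "int p dvd det (mat n n (\<lambda>(i, k). divdiff (\<lambda>_. c) i (m k)))"
  then have "int p dvd (\<Prod>k<n. \<Prod>l<k. int (m k) - int (m l)) * (\<Prod>k<n. c ^ m k)"
    unfolding det_divdiff_const[symmetric] by simp
  then have "(\<exists>k<n. \<exists>l<k. int p dvd int (m k) - int (m l)) \<or> int p dvd c"
    using assms(1) prime_dvd_power[of "int p" c]
    by (auto simp: prime_dvd_mult_iff prime_dvd_prod_iff)
  then obtain k l where "k < n" "l < k" "int p dvd int (m k) - int (m l)"
    using assms(2) by auto
  with m[of l k] zdvd_imp_le[of "int p" "int (m k) - int (m l)"] show False by simp
qed

section \<open>Minors in the powers of the cosine nodes\<close>

lemma inj_on_node: "inj_on (node p) {j. 2 * j < p}"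
proof (rule inj_onI)
  fix i j assume ij: "i \<in> {j. 2 * j < p}" "j \<in> {j. 2 * j < p}" and "node p i = node p j"
  then have "cos (2 * pi * real i / real p) = cos (2 * pi * real j / real p)"
    by (simp add: node_eq_cos)
  moreover have "0 \<le> 2 * pi * real k / real p \<and> 2 * pi * real k / real p \<le> pi"
    if "2 * k < p" for k
  proof -
    have "pi * (2 * real k) \<le> pi * real p" using that by (intro mult_left_mono) auto
    then show ?thesis using that by (simp add: field_simps)
  qed
  ultimately have "2 * pi * real i / real p = 2 * pi * real j / real p"
    using ij cos_inj_pi by blast
  then show "i = j" using ij by (simp add: field_simps)
qed

lemma omega_power_self:
  assumes "0 < p"
  shows "omega p ^ p = 1"
  using assms omega_powi[of p "int p"] by simp

text \<open>
  The negative power is replaced by \<open>p - j\<close>, so that the node becomes a value of a polynomial.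
\<close>
lemma complex_of_real_node_eq_powers:
  assumes "0 < p" "j \<le> p"
  shows "complex_of_real (node p j) = omega p ^ j + omega p ^ (p - j)"
proof -
  have "omega p ^ (p - j) * omega p ^ j = 1"
    using assms by (simp add: omega_power_self flip: power_add)
  then show ?thesis
    by (simp add: complex_of_real_node power_int_minus inverse_unique mult.commute)
qed

text \<open>
  The factorisation \<open>det_node_powers\<close> is applied over the integer polynomials. Its Schur factor \<open>S\<close> is
  specialised in two ways: \<open>T = 1\<close> makes all nodes equal to 2 and shows that \<open>p\<close> does not divide
  \<open>S(1)\<close>, whence \<open>S\<close> does not vanish at \<open>T = \<omega>\<close>, where it is the Schur factor of the minor.
\<close>
lemma det_node_powers_ne_0:
  assumes p: "prime p" "odd p"
    and j: "\<And>r. r < n \<Longrightarrow> 2 * j r < p" "inj_on j {..<n}"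
    and m: "\<And>k l. l < k \<Longrightarrow> k < n \<Longrightarrow> m l < m k \<and> m k < p"
  shows "det (mat n n (\<lambda>(r, k). node p (j r) ^ m k)) \<noteq> 0"
proof -
  have p0: "0 < p" using p(1) prime_gt_0_nat by blast
  let ?x = "\<lambda>r. complex_of_real (node p (j r))"
  let ?e = "\<lambda>f. poly (map_poly of_int f) (omega p)"
  interpret e: comm_ring_hom ?e
    by unfold_locales (auto simp: hom_distribs)
  have at_1: "comm_ring_hom (\<lambda>f. poly f (1::int))"
    by unfold_locales auto
  define a :: "nat \<Rightarrow> int poly" where "a r = monom 1 (j r) + monom 1 (p - j r)" for r
  define S where "S = det (mat n n (\<lambda>(i, k). divdiff a i (m k)))"
  have "poly S 1 = det (map_mat (\<lambda>f. poly f 1) (mat n n (\<lambda>(i, k). divdiff a i (m k))))"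
    by (simp add: S_def comm_ring_hom.hom_det[OF at_1])
  also have "map_mat (\<lambda>f. poly f 1) (mat n n (\<lambda>(i, k). divdiff a i (m k)))
      = mat n n (\<lambda>(i, k). divdiff (\<lambda>_. 2) i (m k))"
    by (rule eq_matI) (auto simp: comm_ring_hom.hom_divdiff[OF at_1] a_def poly_monom)
  finally have "poly S 1 = det (mat n n (\<lambda>(i, k). divdiff (\<lambda>_. 2) i (m k)))" .
  moreover have "\<not> int p dvd 2"
    using p primes_dvd_imp_eq[of p 2] int_dvd_int_iff[of p 2] by (auto simp: two_is_prime_nat)
  ultimately have "\<not> int p dvd poly S 1"
    using not_dvd_det_divdiff_const[OF p(1), of 2 n m] m by simp
  then have S: "?e S \<noteq> 0"
    using prime_dvd_poly_1_of_root_of_unity_root[OF p(1) omega_power_self[OF p0]] by blast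
  have ea: "?e (a r) = ?x r" if "r < n" for r
    using j(1)[OF that] p0
    by (simp add: a_def hom_distribs poly_monom complex_of_real_node_eq_powers)
  have "complex_of_real (det (mat n n (\<lambda>(r, k). node p (j r) ^ m k)))
      = det (mat n n (\<lambda>(r, k). ?x r ^ m k))"
    unfolding of_real_hom.hom_det[symmetric]
    by (rule arg_cong[of _ _ det], rule eq_matI) auto
  also have "mat n n (\<lambda>(r, k). ?x r ^ m k) = map_mat ?e (mat n n (\<lambda>(r, k). a r ^ m k))"
    by (rule eq_matI) (auto simp: e.hom_power ea)
  also have "det \<dots> = ?e (\<Prod>r<n. \<Prod>l<r. a r - a l) * ?e S"
    unfolding e.hom_det det_node_powers S_def e.hom_mult ..
  also have "?e (\<Prod>r<n. \<Prod>l<r. a r - a l) = (\<Prod>r<n. \<Prod>l<r. ?x r - ?x l)"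
    by (simp add: e.hom_prod e.hom_minus ea)
  finally have "complex_of_real (det (mat n n (\<lambda>(r, k). node p (j r) ^ m k)))
      = (\<Prod>r<n. \<Prod>l<r. ?x r - ?x l) * ?e S" .
  moreover have "(\<Prod>r<n. \<Prod>l<r. ?x r - ?x l) \<noteq> 0"
  proof -
    have "node p (j r) \<noteq> node p (j l)" if "r < n" "l < r" for r l
      using that j inj_onD[OF inj_on_node, of p "j r" "j l"] inj_onD[OF j(2), of r l] by auto
    then show ?thesis by auto
  qed
  ultimately show ?thesis using S by auto
qed

theorem theorem2:
  fixes p :: nat and I J :: "nat set"
  assumes "prime p" and "odd p"
    and "I \<subseteq> {0..<(p - 1) div 2}" and "J \<subseteq> {0..<(p - 1) div 2}"
    and "card I = card J" and "I \<noteq> {}" and "J \<noteq> {}"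
  shows "Determinant.det (submatrix (vandermonde_mat p) I J) \<noteq> 0"
proof -
  define h where "h = (p - 1) div 2"
  let ?n = "card I"
  have I: "pick I r < h" if "r < ?n" for r
    using that pick_in_set[of r I] assms(3) by (auto simp: h_def)
  have J: "pick J k < h" if "k < ?n" for k
    using that pick_in_set[of k J] assms(4,5) by (auto simp: h_def)
  have eq: "{i. i < h \<and> i \<in> I} = I" "{i. i < h \<and> i \<in> J} = J"
    using assms(3,4) by (auto simp: h_def)
  have V: "vandermonde_mat p = mat h h (\<lambda>(j, m). node p (j + 1) ^ (m + 1))"
    by (simp add: vandermonde_mat_def h_def)
  have "submatrix (vandermonde_mat p) I J
      = mat ?n ?n (\<lambda>(r, k). node p (pick I r + 1) ^ (pick J k + 1))"
    using I J
    by (intro eq_matI) (auto simp: submatrix_def V eq assms(5))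
  also have "det \<dots> \<noteq> 0"
  proof (rule det_node_powers_ne_0[OF assms(1,2)])
    show "2 * (pick I r + 1) < p" if "r < ?n" for r
      using I[OF that] assms(2) unfolding h_def by presburger
    show "inj_on (\<lambda>r. pick I r + 1) {..<?n}"
      by (intro linorder_inj_onI) (auto simp: less_imp_neq[OF pick_mono])
    show "pick J l + 1 < pick J k + 1 \<and> pick J k + 1 < p" if "l < k" "k < ?n" for k l
      using pick_mono[of k J l] J[of k] that assms(5) by (auto simp: h_def)
  qed
  finally show ?thesis .
qed

end
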